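(* Let $H$ be a separable complex Hilbert space with orthonormal basis $\{e_n\}_{n=1}^{\infty}$, and let $S \in B(H)$ be a hyponormal operator with $S e_n = a_n e_{n+1}$ for all $n \ge 1$, where $\{a_n\}_{n=1}^\infty$ is a sequence of real numbers. If there exists an integer $i \ge 3$ such that $0 < a_1 < a_2 < \cdots < a_{i-1} < a_i$ and $a_n = a_i$ for all $n \ge i+1$, then $S$ is near subnormal but not subnormal.
   Context: $B(H)$ is the algebra of all bounded linear operators on $H$. An operator $A \in B(H)$ is hyponormal if $Q_A := A^*A - AA^* \ge 0$. A hyponormal operator $A$ is called near subnormal if there exists a constant $m > 0$ such that $Q_A \ge m\, A^* Q_A A$. An operator $A \in B(H)$ is subnormal if there exist a Hilbert space $K$ containing $H$ as a closed subspace and a normal operator $N \in B(K)$ such that $N H \subseteq H$ and $N|_H = A$. *)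

theory Defs
  imports "HOL-Analysis.Analysis"
begin

class complex_vector = real_vector +
  fixes scaleC :: "complex \<Rightarrow> 'a \<Rightarrow> 'a" (infixr "*\<^sub>C" 75)
  assumes scaleC_add_right: "c *\<^sub>C (x + y) = c *\<^sub>C x + c *\<^sub>C y"
    and scaleC_add_left: "(b + c) *\<^sub>C x = b *\<^sub>C x + c *\<^sub>C x"
    and scaleC_scaleC: "b *\<^sub>C c *\<^sub>C x = (b * c) *\<^sub>C x"
    and scaleC_one: "1 *\<^sub>C x = x"
    and scaleR_scaleC: "r *\<^sub>R x = complex_of_real r *\<^sub>C x"

text \<open>The inner product is linear in the first and conjugate-linear in the second argument.\<close>

class complex_inner = complex_vector + real_normed_vector +
  fixes cinner :: "'a \<Rightarrow> 'a \<Rightarrow> complex"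
  assumes cinner_commute: "cinner x y = cnj (cinner y x)"
    and cinner_add_left: "cinner (x + y) z = cinner x z + cinner y z"
    and cinner_scaleC_left: "cinner (c *\<^sub>C x) y = c * cinner x y"
    and cinner_ge_zero: "0 \<le> Re (cinner x x)"
    and cinner_eq_zero_iff: "cinner x x = 0 \<longleftrightarrow> x = 0"
    and norm_eq_sqrt_cinner: "norm x = sqrt (Re (cinner x x))"

class complex_hilbert = complex_inner + complete_space

definition clinear :: "('a::complex_vector \<Rightarrow> 'b::complex_vector) \<Rightarrow> bool" where
  "clinear A \<longleftrightarrow> (\<forall>x y. A (x + y) = A x + A y) \<and> (\<forall>c x. A (c *\<^sub>C x) = c *\<^sub>C A x)"

definition bounded_clinear :: "('a::complex_inner \<Rightarrow> 'b::complex_inner) \<Rightarrow> bool" where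
  "bounded_clinear A \<longleftrightarrow> clinear A \<and> (\<exists>K. \<forall>x. norm (A x) \<le> K * norm x)"

text \<open>For a bounded operator on a Hilbert space the description below has exactly one solution,
  by the Riesz representation theorem.\<close>

definition adjoint_op :: "('a::complex_hilbert \<Rightarrow> 'a) \<Rightarrow> 'a \<Rightarrow> 'a" where
  "adjoint_op A = (THE B. \<forall>x y. cinner (A x) y = cinner x (B y))"

definition positive_op :: "('a::complex_hilbert \<Rightarrow> 'a) \<Rightarrow> bool" where
  "positive_op A \<longleftrightarrow> (\<forall>x. Im (cinner (A x) x) = 0 \<and> 0 \<le> Re (cinner (A x) x))"

definition op_ge :: "('a::complex_hilbert \<Rightarrow> 'a) \<Rightarrow> ('a \<Rightarrow> 'a) \<Rightarrow> bool" where
  "op_ge A B \<longleftrightarrow> positive_op (\<lambda>x. A x - B x)"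

definition self_commutator :: "('a::complex_hilbert \<Rightarrow> 'a) \<Rightarrow> 'a \<Rightarrow> 'a" where
  "self_commutator A = (\<lambda>x. adjoint_op A (A x) - A (adjoint_op A x))"

definition hyponormal :: "('a::complex_hilbert \<Rightarrow> 'a) \<Rightarrow> bool" where
  "hyponormal A \<longleftrightarrow> bounded_clinear A \<and> op_ge (self_commutator A) (\<lambda>x. 0)"

definition near_subnormal :: "('a::complex_hilbert \<Rightarrow> 'a) \<Rightarrow> bool" where
  "near_subnormal A \<longleftrightarrow> hyponormal A \<and>
     (\<exists>m::real. m > 0 \<and>
        op_ge (self_commutator A) (\<lambda>x. m *\<^sub>R adjoint_op A (self_commutator A (A x))))"

definition normal_op :: "('a::complex_hilbert \<Rightarrow> 'a) \<Rightarrow> bool" where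
  "normal_op N \<longleftrightarrow> bounded_clinear N \<and> adjoint_op N \<circ> N = N \<circ> adjoint_op N"

text \<open>The type argument \<open>'k\<close> is the larger space \<open>K\<close>, since HOL cannot quantify over types inside
  a formula; the negation of \<open>subnormal_in TYPE('k) A\<close> for a free type variable \<open>'k\<close> therefore
  says that no Hilbert space whatsoever carries a normal extension of \<open>A\<close>. The smaller space is
  identified with its image under a linear isometry \<open>V\<close>, which is a closed subspace by completeness;
  \<open>N (V x) = V (A x)\<close> expresses both the invariance of that subspace and that \<open>N\<close> restricts
  to \<open>A\<close> on it.\<close>

definition subnormal_in :: "'k::complex_hilbert itself \<Rightarrow> ('h::complex_hilbert \<Rightarrow> 'h) \<Rightarrow> bool" where
  "subnormal_in K A \<longleftrightarrow> bounded_clinear A \<and>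
     (\<exists>(V :: 'h \<Rightarrow> 'k) (N :: 'k \<Rightarrow> 'k).
        clinear V \<and> (\<forall>x y. cinner (V x) (V y) = cinner x y) \<and>
        normal_op N \<and> (\<forall>x. N (V x) = V (A x)))"

definition orthonormal_basis :: "'i set \<Rightarrow> ('i \<Rightarrow> 'a::complex_hilbert) \<Rightarrow> bool" where
  "orthonormal_basis I e \<longleftrightarrow>
     (\<forall>i\<in>I. \<forall>j\<in>I. cinner (e i) (e j) = (if i = j then 1 else 0)) \<and>
     closure (module.span scaleC (e ` I)) = UNIV"

end

theory Submission
  imports Defs
begin

text \<open>In the basis, \<open>Q = S\<^sup>* S - S S\<^sup>*\<close> is diagonal with entries \<open>d\<^sub>n = a\<^sub>n\<^sup>2 - a\<^sub>n\<^sub>-\<^sub>1\<^sup>2\<close>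
  (where \<open>a\<^sub>0 = 0\<close>), and \<open>S\<^sup>* Q S\<close> is diagonal with entries \<open>a\<^sub>n\<^sup>2 d\<^sub>n\<^sub>+\<^sub>1\<close>. The latter vanish for
  \<open>n \<ge> i\<close> while \<open>d\<^sub>n > 0\<close> for \<open>n \<le> i\<close>, so finitely many ratios determine a suitable \<open>m\<close>.

  If \<open>N\<close> were a normal extension, then with \<open>c = a\<^sub>i = a\<^sub>i\<^sub>+\<^sub>1\<close> equality in the Cauchy-Schwarz inequality
  would give \<open>N\<^sup>* N e\<^sub>i = c\<^sup>2 e\<^sub>i\<close>. Then \<open>w = N\<^sup>* N u - c\<^sup>2 u\<close> with \<open>u = e\<^sub>i\<^sub>-\<^sub>1\<close> lies in the kernel of \<open>N\<close>,
  hence in that of \<open>N\<^sup>*\<close>, so \<open>w\<close> is orthogonal to the range of \<open>N\<close>, which contains \<open>u\<close> because \<open>i \<ge> 3\<close>.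
  Therefore \<open>w = 0\<close>, and \<open>a\<^sub>i\<^sub>-\<^sub>1 = norm (N u) = c\<close>, contradicting \<open>a\<^sub>i\<^sub>-\<^sub>1 < a\<^sub>i\<close>.\<close>

section \<open>Complex inner product spaces\<close>

lemma module_scaleC: "module (scaleC :: complex \<Rightarrow> 'a::complex_vector \<Rightarrow> 'a)"
  by unfold_locales (simp_all add: scaleC_add_right scaleC_add_left scaleC_scaleC scaleC_one)

interpretation cvec: module "scaleC :: complex \<Rightarrow> 'a::complex_vector \<Rightarrow> 'a"
  by (rule module_scaleC)

lemma cinner_add_right: "cinner (x::'a::complex_inner) (y + z) = cinner x y + cinner x z"
  unfolding cinner_commute[of x] by (simp add: cinner_add_left)

lemma cinner_scaleC_right: "cinner (x::'a::complex_inner) (c *\<^sub>C y) = cnj c * cinner x y"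
  unfolding cinner_commute[of x] by (simp add: cinner_scaleC_left)

lemma cinner_scaleR_left: "cinner (r *\<^sub>R x) y = r *\<^sub>R cinner (x::'a::complex_inner) y"
  by (simp add: scaleR_scaleC cinner_scaleC_left scaleR_conv_of_real)

lemma cinner_scaleR_right: "cinner x (r *\<^sub>R y) = r *\<^sub>R cinner (x::'a::complex_inner) y"
  by (simp add: scaleR_scaleC cinner_scaleC_right scaleR_conv_of_real)

lemma cinner_zero_left [simp]: "cinner 0 (x::'a::complex_inner) = 0"
  using cinner_add_left[of 0 0 x] by simp

lemma cinner_zero_right [simp]: "cinner (x::'a::complex_inner) 0 = 0"
  using cinner_add_right[of x 0 0] by simp

lemma cinner_minus_right: "cinner x (- y) = - cinner (x::'a::complex_inner) y"
  using cinner_scaleR_right[of x "-1" y] by simp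

lemma cinner_diff_left: "cinner (x - y) z = cinner (x::'a::complex_inner) z - cinner y z"
  using cinner_add_left[of "x - y" y z] by simp

lemma cinner_diff_right: "cinner x (y - z) = cinner (x::'a::complex_inner) y - cinner x z"
  using cinner_add_right[of x "y - z" z] by simp

lemma cinner_self: "cinner x x = complex_of_real ((norm (x::'a::complex_inner))\<^sup>2)"
proof -
  have "Im (cinner x x) = 0"
    using arg_cong[OF cinner_commute[of x x], of Im] by simp
  then show ?thesis
    by (simp add: complex_eq_iff norm_eq_sqrt_cinner cinner_ge_zero)
qed

lemma norm_scaleC: "norm (c *\<^sub>C x) = cmod c * norm (x::'a::complex_inner)"
proof -
  have "cinner (c *\<^sub>C x) (c *\<^sub>C x) = (c * cnj c) * cinner x x"
    by (simp add: cinner_scaleC_left cinner_scaleC_right)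
  then have "complex_of_real ((norm (c *\<^sub>C x))\<^sup>2) = complex_of_real ((cmod c * norm x)\<^sup>2)"
    by (simp add: cinner_self power_mult_distrib flip: complex_norm_square)
  then have "(norm (c *\<^sub>C x))\<^sup>2 = (cmod c * norm x)\<^sup>2"
    using of_real_eq_iff by blast
  then show ?thesis
    by (simp add: power2_eq_iff_nonneg)
qed

lemma norm_add_square:
  fixes x y :: "'a::complex_inner"
  shows "(norm (x + y))\<^sup>2 = (norm x)\<^sup>2 + 2 * Re (cinner x y) + (norm y)\<^sup>2"
proof -
  have "cinner (x + y) (x + y) = cinner x x + (cinner x y + cnj (cinner x y)) + cinner y y"
    using cinner_commute[of y x] by (simp add: cinner_add_left cinner_add_right)
  from arg_cong[OF this, of Re] show ?thesis
    by (simp add: cinner_self)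
qed

lemma norm_diff_square:
  fixes x y :: "'a::complex_inner"
  shows "(norm (x - y))\<^sup>2 = (norm x)\<^sup>2 - 2 * Re (cinner x y) + (norm y)\<^sup>2"
  using norm_add_square[of x "- y"] by (simp add: cinner_minus_right)

text \<open>The norm axioms already contain the triangle inequality, so squaring and expanding it
  gives the real part of Cauchy-Schwarz directly.\<close>

lemma Re_cinner_le: "Re (cinner x y) \<le> norm x * norm (y::'a::complex_inner)"
proof -
  have "(norm (x + y))\<^sup>2 \<le> (norm x + norm y)\<^sup>2"
    by (simp add: norm_triangle_ineq power_mono)
  then show ?thesis
    by (simp add: norm_add_square power2_sum)
qed

lemma cauchy_schwarz: "cmod (cinner x y) \<le> norm x * norm (y::'a::complex_inner)"
proof -
  \<comment> \<open>Multiplying \<open>x\<close> by this phase makes the inner product real and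
    nonnegative. Since \<open>sgn 0 = 0\<close>, only \<open>cmod u \<le> 1\<close> is available in
    general.\<close>
  define u where "u = cnj (sgn (cinner x y))"
  have "u * cinner x y = of_real (cmod (cinner x y))"
    using complex_norm_square[of "cinner x y"]
    by (cases "cinner x y = 0") (simp_all add: u_def sgn_eq power2_eq_square field_simps)
  then have "cmod (cinner x y) = Re (cinner (u *\<^sub>C x) y)"
    by (simp add: cinner_scaleC_left)
  also have "\<dots> \<le> cmod u * norm x * norm y"
    using Re_cinner_le[of "u *\<^sub>C x" y] by (simp add: norm_scaleC)
  also have "\<dots> \<le> 1 * norm x * norm y"
    by (intro mult_right_mono) (simp_all add: u_def norm_sgn)
  finally show ?thesis by simp
qed

lemma bounded_bilinear_cinner: "bounded_bilinear (cinner :: 'a::complex_inner \<Rightarrow> 'a \<Rightarrow> complex)"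
proof
  show "\<exists>K. \<forall>(x::'a) y. norm (cinner x y) \<le> norm x * norm y * K"
    by (rule exI[of _ 1]) (simp add: cauchy_schwarz)
qed (simp_all add: cinner_add_left cinner_add_right cinner_scaleR_left cinner_scaleR_right)

interpretation cinner: bounded_bilinear "cinner :: 'a::complex_inner \<Rightarrow> 'a \<Rightarrow> complex"
  by (rule bounded_bilinear_cinner)

lemma cinner_right_eqI:
  fixes y z :: "'a::complex_inner"
  assumes "\<And>x. cinner x y = cinner x z"
  shows "y = z"
proof -
  have "cinner (y - z) (y - z) = 0"
    using assms by (simp add: cinner_diff_right)
  then show ?thesis by (simp add: cinner_eq_zero_iff)
qed

section \<open>Bounded operators\<close>

lemma clinear_add: "clinear A \<Longrightarrow> A (x + y) = A x + A y"
  by (simp add: clinear_def)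

lemma clinear_scaleC: "clinear A \<Longrightarrow> A (c *\<^sub>C x) = c *\<^sub>C A x"
  by (simp add: clinear_def)

lemma clinear_imp_linear: "clinear A \<Longrightarrow> linear A"
  by (rule linearI) (simp_all add: clinear_def scaleR_scaleC)

lemma bounded_clinear_clinear: "bounded_clinear A \<Longrightarrow> clinear A"
  by (simp add: bounded_clinear_def)

lemma bounded_clinear_imp_bounded_linear: "bounded_clinear A \<Longrightarrow> bounded_linear A"
  unfolding bounded_clinear_def bounded_linear_def bounded_linear_axioms_def
  by (metis clinear_imp_linear mult.commute)

lemma bounded_clinearI: "clinear A \<Longrightarrow> (\<And>x. norm (A x) \<le> K * norm x) \<Longrightarrow> bounded_clinear A"
  by (auto simp: bounded_clinear_def)

lemma bounded_clinearI_bounded_linear: "clinear A \<Longrightarrow> bounded_linear A \<Longrightarrow> bounded_clinear A"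
  by (metis bounded_clinearI bounded_linear.bounded mult.commute)

lemma bounded_clinear_compose:
  assumes "bounded_clinear A" "bounded_clinear B"
  shows "bounded_clinear (\<lambda>x. A (B x))"
proof (rule bounded_clinearI_bounded_linear)
  show "clinear (\<lambda>x. A (B x))"
    using assms by (simp add: bounded_clinear_def clinear_def)
  show "bounded_linear (\<lambda>x. A (B x))"
    by (rule bounded_linear_compose[OF assms[THEN bounded_clinear_imp_bounded_linear]])
qed

lemma bounded_clinear_diff:
  assumes "bounded_clinear A" "bounded_clinear B"
  shows "bounded_clinear (\<lambda>x. A x - B x)"
proof (rule bounded_clinearI_bounded_linear)
  show "clinear (\<lambda>x. A x - B x)"
    using assms by (simp add: bounded_clinear_def clinear_def cvec.scale_right_diff_distrib)
  show "bounded_linear (\<lambda>x. A x - B x)"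
    using assms by (intro bounded_linear_sub bounded_clinear_imp_bounded_linear)
qed

lemma bounded_clinear_scaleR:
  assumes "bounded_clinear A"
  shows "bounded_clinear (\<lambda>x. r *\<^sub>R A x)"
proof (rule bounded_clinearI_bounded_linear)
  show "clinear (\<lambda>x. r *\<^sub>R A x)"
    using assms
    by (simp add: bounded_clinear_def clinear_def scaleR_scaleC scaleC_add_right scaleC_scaleC mult.commute)
  show "bounded_linear (\<lambda>x. r *\<^sub>R A x)"
    using assms
    by (intro bounded_linear_const_scaleR bounded_clinear_imp_bounded_linear)
qed

section \<open>Riesz representation and adjoints\<close>

text \<open>First-order condition at a minimum: \<open>t = - b / (c + 1)\<close> gives the value
  \<open>- (b / (c + 1))\<^sup>2\<close>. The shift by 1 keeps the denominator positive when
  \<open>c = 0\<close>.\<close>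

lemma linear_coeff_zero_of_quadratic_nonneg:
  fixes b c :: real
  assumes nonneg: "\<And>t. 0 \<le> t * b + t\<^sup>2 * c" and "0 \<le> c"
  shows "b = 0"
proof (rule ccontr)
  assume "b \<noteq> 0"
  define k where "k = c + 1"
  have c: "c = k - 1" and k: "k > 0"
    using \<open>0 \<le> c\<close> by (auto simp: k_def)
  have "(- b / k) * b + (- b / k)\<^sup>2 * c = - (b\<^sup>2 / k\<^sup>2)"
    unfolding c using k by (simp add: field_simps power2_eq_square)
  moreover have "b\<^sup>2 / k\<^sup>2 > 0"
    using \<open>b \<noteq> 0\<close> k by simp
  ultimately show False
    using nonneg[of "- b / k"] by linarith
qed

text \<open>The representing vector is found as the minimiser of \<open>\<lambda>x. (norm x)\<^sup>2 - 2 * Re (f x)\<close>;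
  by the parallelogram law every minimising sequence is Cauchy.\<close>

lemma riesz_representation:
  fixes f :: "'a::complex_hilbert \<Rightarrow> complex"
  assumes add: "\<And>x y. f (x + y) = f x + f y" and scale: "\<And>c x. f (c *\<^sub>C x) = c * f x"
    and bound: "\<And>x. cmod (f x) \<le> K * norm x"
  shows "\<exists>y. \<forall>x. f x = cinner x y"
proof -
  define \<phi> where "\<phi> x = (norm x)\<^sup>2 - 2 * Re (f x)" for x
  define I where "I = Inf (range \<phi>)"
  have f_scaleR: "f (r *\<^sub>R x) = r *\<^sub>R f x" for r x
    by (simp add: scaleR_scaleC scale scaleR_conv_of_real)
  have f_lin: "bounded_linear f"
    by (rule bounded_linear_intro[where K = K]) (simp_all add: add f_scaleR bound mult.commute)
  have "- K\<^sup>2 \<le> \<phi> x" for x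
  proof -
    have "Re (f x) \<le> K * norm x"
      by (rule order_trans[OF complex_Re_le_cmod bound])
    moreover have "0 \<le> (norm x - K)\<^sup>2" by simp
    ultimately show ?thesis
      by (simp add: \<phi>_def power2_diff algebra_simps)
  qed
  then have bdd: "bdd_below (range \<phi>)"
    by (auto simp: bdd_below_def)
  have I_le: "I \<le> \<phi> x" for x
    unfolding I_def by (rule cInf_lower[OF _ bdd]) simp
  have "\<exists>x. \<phi> x < I + inverse (real (Suc n))" for n
    using cInf_lessD[of "range \<phi>" "I + inverse (real (Suc n))"] unfolding I_def by auto
  then obtain X where X: "\<And>n. \<phi> (X n) < I + inverse (real (Suc n))"
    by metis
  \<comment> \<open>The midpoint of \<open>x\<close> and \<open>y\<close> also has value at least
    \<open>I\<close>, so two near-minimisers must be close.\<close>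
  have par: "(norm (x - y))\<^sup>2 \<le> 2 * (\<phi> x + \<phi> y - 2 * I)" for x y
  proof -
    have "norm ((1/2) *\<^sub>R (x + y)) = norm (x + y) / 2" by simp
    then have "\<phi> ((1/2) *\<^sub>R (x + y)) = (norm (x + y))\<^sup>2 / 4 - (Re (f x) + Re (f y))"
      unfolding \<phi>_def f_scaleR by (simp add: power_divide add add_divide_distrib del: scaleR_add_right)
    then show ?thesis
      using I_le[of "(1/2) *\<^sub>R (x + y)"]
      unfolding \<phi>_def norm_diff_square norm_add_square by (simp add: field_simps)
  qed
  have "Cauchy X"
  proof (rule metric_CauchyI)
    fix \<epsilon> :: real assume "0 < \<epsilon>"
    then obtain M where M: "inverse (real (Suc M)) < \<epsilon>\<^sup>2 / 4"
      using reals_Archimedean[of "\<epsilon>\<^sup>2 / 4"] by auto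
    have "dist (X m) (X n) < \<epsilon>" if "M \<le> m" "M \<le> n" for m n
    proof -
      have *: "\<phi> (X k) < I + \<epsilon>\<^sup>2 / 4" if "M \<le> k" for k
      proof -
        have "inverse (real (Suc k)) \<le> inverse (real (Suc M))"
          using that by (intro le_imp_inverse_le) auto
        then show ?thesis using M X[of k] by linarith
      qed
      have "(norm (X m - X n))\<^sup>2 < \<epsilon>\<^sup>2"
        using par[of "X m" "X n"] *[OF that(1)] *[OF that(2)] by (simp add: field_simps)
      then show ?thesis
        using \<open>0 < \<epsilon>\<close> by (simp add: dist_norm power2_less_imp_less)
    qed
    then show "\<exists>M. \<forall>m\<ge>M. \<forall>n\<ge>M. dist (X m) (X n) < \<epsilon>" by blast
  qed
  then obtain y where y: "X \<longlonglongrightarrow> y"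
    using Cauchy_convergent convergentD by blast
  have "(\<lambda>n. \<phi> (X n)) \<longlonglongrightarrow> \<phi> y"
    unfolding \<phi>_def by (intro tendsto_intros bounded_linear.tendsto[OF f_lin] y)
  moreover have "(\<lambda>n. I + inverse (real (Suc n))) \<longlonglongrightarrow> I + 0"
    by (intro tendsto_intros LIMSEQ_inverse_real_of_nat)
  ultimately have "\<phi> y \<le> I + 0"
    by (rule LIMSEQ_le) (use X less_imp_le in blast)
  then have "\<phi> y \<le> I" by simp
  \<comment> \<open>Moving from the minimiser \<open>y\<close> in direction \<open>h\<close> cannot
    decrease \<open>\<phi>\<close>, so the coefficient linear in \<open>t\<close> vanishes.\<close>
  have Re_eq: "Re (f h) = Re (cinner h y)" for h
  proof -
    have "0 \<le> t * (2 * (Re (cinner y h) - Re (f h))) + t\<^sup>2 * (norm h)\<^sup>2" for t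
    proof -
      have "\<phi> y \<le> \<phi> (y + t *\<^sub>R h)"
        by (rule order_trans[OF \<open>\<phi> y \<le> I\<close> I_le])
      then show ?thesis
        by (simp add: \<phi>_def norm_add_square add f_scaleR cinner_scaleR_right power_mult_distrib
            algebra_simps)
    qed
    then have "2 * (Re (cinner y h) - Re (f h)) = 0"
      by (rule linear_coeff_zero_of_quadratic_nonneg) simp
    then show ?thesis
      using cinner_commute[of h y] by simp
  qed
  \<comment> \<open>The direction \<open>\<i> *\<^sub>C h\<close> turns the identity of real parts
    into that of imaginary parts.\<close>
  have "f h = cinner h y" for h
    using Re_eq[of h] Re_eq[of "\<i> *\<^sub>C h"]
    by (simp add: scale cinner_scaleC_left complex_eq_iff)
  then show ?thesis by blast
qed

text \<open>Discharges the definite description in \<open>adjoint_op\<close>: Riesz gives existence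
  for each \<open>y\<close>, and a vector is determined by its inner products.\<close>

lemma cinner_adjoint_right:
  assumes A: "bounded_clinear A"
  shows "cinner (A x) y = cinner x (adjoint_op A y)"
proof -
  obtain K where K: "\<And>x. norm (A x) \<le> K * norm x"
    using A by (auto simp: bounded_clinear_def)
  note A' = bounded_clinear_clinear[OF A]
  have "\<exists>z. \<forall>x. cinner (A x) y = cinner x z" for y
  proof (rule riesz_representation)
    show "cmod (cinner (A x) y) \<le> (K * norm y) * norm x" for x
      using order_trans[OF cauchy_schwarz mult_right_mono[OF K[of x] norm_ge_zero[of y]]]
      by (simp add: mult_ac)
  qed (simp_all add: clinear_add[OF A'] clinear_scaleC[OF A'] cinner_add_left cinner_scaleC_left)
  then obtain B where B: "\<forall>x y. cinner (A x) y = cinner x (B y)"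
    by metis
  have "\<forall>x y. cinner (A x) y = cinner x (adjoint_op A y)"
    unfolding adjoint_op_def
  proof (rule theI[where a = B])
    show "C = B" if "\<forall>x y. cinner (A x) y = cinner x (C y)" for C
      using that B by (intro ext cinner_right_eqI) simp
  qed (rule B)
  then show ?thesis by blast
qed

lemma cinner_adjoint_left:
  assumes A: "bounded_clinear A"
  shows "cinner (adjoint_op A x) y = cinner x (A y)"
  using cinner_adjoint_right[OF A, of y x] cinner_commute[of "adjoint_op A x" y]
    cinner_commute[of x "A y"] by simp

text \<open>The square of \<open>norm (adjoint_op A y)\<close> is
  \<open>Re (cinner (A (adjoint_op A y)) y)\<close>; cancelling one factor leaves the bound
  \<open>K\<close> of \<open>A\<close>.\<close>

lemma bounded_clinear_adjoint:
  assumes A: "bounded_clinear A"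
  shows "bounded_clinear (adjoint_op A)"
proof -
  obtain K where K: "\<And>x. norm (A x) \<le> K * norm x"
    using A by (auto simp: bounded_clinear_def)
  have "clinear (adjoint_op A)"
    unfolding clinear_def
    by (intro conjI allI cinner_right_eqI;
        simp add: cinner_add_right cinner_scaleC_right flip: cinner_adjoint_right[OF A])
  moreover have "norm (adjoint_op A y) \<le> K * norm y" for y
  proof (cases "adjoint_op A y = 0")
    case True
    have "0 \<le> K * norm y" by (rule order_trans[OF norm_ge_zero K])
    then show ?thesis using True by simp
  next
    case False
    have "(norm (adjoint_op A y))\<^sup>2 = Re (cinner (A (adjoint_op A y)) y)"
      by (simp add: cinner_adjoint_right[OF A] cinner_self)
    also have "\<dots> \<le> norm (A (adjoint_op A y)) * norm y"
      by (rule Re_cinner_le)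
    also have "\<dots> \<le> K * norm (adjoint_op A y) * norm y"
      by (intro mult_right_mono K) simp
    finally show ?thesis
      using False by (simp add: power2_eq_square mult_ac)
  qed
  ultimately show ?thesis by (rule bounded_clinearI)
qed

lemma bounded_clinear_self_commutator:
  assumes A: "bounded_clinear A"
  shows "bounded_clinear (self_commutator A)"
  unfolding self_commutator_def
  by (intro bounded_clinear_diff bounded_clinear_compose[OF bounded_clinear_adjoint[OF A] A]
      bounded_clinear_compose[OF A bounded_clinear_adjoint[OF A]])

text \<open>Both squared norms are quadratic forms of the same operator, by commutation. In
  particular \<open>N\<close> and its adjoint have equal kernels.\<close>

lemma normal_op_norm_adjoint:
  assumes "normal_op N"
  shows "norm (adjoint_op N x) = norm (N x)"
proof -
  have N: "bounded_clinear N" and comm: "adjoint_op N (N x) = N (adjoint_op N x)"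
    using assms by (auto simp: normal_op_def fun_eq_iff)
  have "cinner (adjoint_op N x) (adjoint_op N x) = cinner (N x) (N x)"
    by (simp add: cinner_adjoint_left[OF N] cinner_adjoint_right[OF N] comm)
  then show ?thesis by (simp add: norm_eq_sqrt_cinner)
qed

section \<open>Orthonormal bases\<close>

text \<open>The vectors orthogonal to \<open>y - z\<close> form a closed subspace containing the
  basis, hence everything, including \<open>y - z\<close> itself.\<close>

lemma orthonormal_basis_eqI:
  assumes e: "orthonormal_basis I e" and eq: "\<And>n. n \<in> I \<Longrightarrow> cinner (e n) y = cinner (e n) z"
  shows "y = z"
proof -
  define Z where "Z = {x. cinner x (y - z) = 0}"
  have "cvec.subspace Z"
    by (rule cvec.subspaceI) (simp_all add: Z_def cinner_add_left cinner_scaleC_left)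
  moreover have "e ` I \<subseteq> Z"
    using eq by (auto simp: Z_def cinner_diff_right)
  ultimately have "cvec.span (e ` I) \<subseteq> Z"
    by (rule cvec.span_minimal[rotated])
  moreover have "closed Z"
    unfolding Z_def by (intro closed_Collect_eq continuous_intros cinner.continuous_on)
  ultimately have "closure (cvec.span (e ` I)) \<subseteq> Z"
    by (rule closure_minimal)
  then have "y - z \<in> Z"
    using e by (auto simp: orthonormal_basis_def)
  then show ?thesis by (simp add: Z_def cinner_eq_zero_iff)
qed

text \<open>On finite combinations of basis vectors the quadratic form is a nonnegative sum;
  continuity extends this to the closure. \<open>P\<close> is not known to be a subspace, so the
  span is treated by explicit sums.\<close>

lemma positive_op_diagonal:
  assumes T: "bounded_clinear T" and e: "orthonormal_basis I e"
    and diag: "\<And>n. n \<in> I \<Longrightarrow> T (e n) = complex_of_real (d n) *\<^sub>C e n"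
    and nonneg: "\<And>n. n \<in> I \<Longrightarrow> 0 \<le> d n"
  shows "positive_op T"
proof -
  define P where "P = {x. Im (cinner (T x) x) = 0 \<and> 0 \<le> Re (cinner (T x) x)}"
  have lin: "linear T"
    using T bounded_clinear_clinear clinear_imp_linear by blast
  \<comment> \<open>Elements of the span are sums over vectors, not indices, so the eigenvalues are
    re-indexed by vectors.\<close>
  have "\<forall>v\<in>e ` I. \<exists>s\<ge>0. T v = complex_of_real s *\<^sub>C v"
    using diag nonneg by blast
  from bchoice[OF this] obtain s where s: "\<And>v. v \<in> e ` I \<Longrightarrow> 0 \<le> s v"
      "\<And>v. v \<in> e ` I \<Longrightarrow> T v = complex_of_real (s v) *\<^sub>C v"
    by blast
  have orth: "cinner v w = (if v = w then 1 else 0)" if vw: "v \<in> e ` I" "w \<in> e ` I" for v w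
  proof -
    obtain i j where ij: "i \<in> I" "v = e i" "j \<in> I" "w = e j"
      using vw by blast
    then have "cinner v w = (if i = j then 1 else 0)" "cinner v v = 1"
      using e by (auto simp: orthonormal_basis_def)
    then show ?thesis
      using ij by (cases "v = w") auto
  qed
  have "cvec.span (e ` I) \<subseteq> P"
  proof
    fix x assume "x \<in> cvec.span (e ` I)"
    then obtain t r where t: "finite t" "t \<subseteq> e ` I" and x: "x = (\<Sum>v\<in>t. r v *\<^sub>C v)"
      unfolding cvec.span_explicit by blast
    have "T x = (\<Sum>v\<in>t. T (r v *\<^sub>C v))"
      by (simp add: x linear_sum[OF lin])
    also have "\<dots> = (\<Sum>v\<in>t. (r v * of_real (s v)) *\<^sub>C v)"
      using t(2) by (intro sum.cong)
        (auto simp: clinear_scaleC[OF bounded_clinear_clinear[OF T]] s scaleC_scaleC)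
    finally have Tx: "T x = (\<Sum>v\<in>t. (r v * of_real (s v)) *\<^sub>C v)" .
    have "cinner (T x) x
        = (\<Sum>v\<in>t. \<Sum>w\<in>t. r v * of_real (s v) * (cnj (r w) * cinner v w))"
      unfolding Tx unfolding x
      by (simp add: cinner.sum_left cinner.sum_right cinner_scaleC_left cinner_scaleC_right
          sum_distrib_left)
        (subst sum.swap, simp add: mult_ac)
    also have "\<dots> = (\<Sum>v\<in>t. \<Sum>w\<in>t. if v = w then r v * of_real (s v) * cnj (r v) else 0)"
      using t(2) by (intro sum.cong refl) (auto simp: orth subsetD)
    also have "\<dots> = (\<Sum>v\<in>t. of_real (s v * (cmod (r v))\<^sup>2))"
      using t(1) by (intro sum.cong) (simp_all add: complex_norm_square mult_ac del: of_real_power)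
    finally have "cinner (T x) x = of_real (\<Sum>v\<in>t. s v * (cmod (r v))\<^sup>2)"
      by simp
    moreover have "0 \<le> (\<Sum>v\<in>t. s v * (cmod (r v))\<^sup>2)"
      using t(2) s(1) by (intro sum_nonneg) auto
    ultimately show "x \<in> P" by (simp add: P_def)
  qed
  moreover have "closed P"
  proof -
    have "continuous_on UNIV (\<lambda>x. cinner (T x) x)"
      by (intro cinner.continuous_on continuous_on_id
          bounded_linear.continuous_on[OF bounded_clinear_imp_bounded_linear[OF T]])
    then show ?thesis
      unfolding P_def
      by (intro closed_Collect_conj closed_Collect_eq closed_Collect_le continuous_intros)
  qed
  ultimately have "closure (cvec.span (e ` I)) \<subseteq> P"
    by (rule closure_minimal)
  then show ?thesis
    using e by (auto simp: orthonormal_basis_def P_def positive_op_def)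
qed

section \<open>Weighted shifts\<close>

locale weighted_shift =
  fixes e :: "nat \<Rightarrow> 'h::complex_hilbert" and S :: "'h \<Rightarrow> 'h" and a :: "nat \<Rightarrow> real"
  assumes basis: "orthonormal_basis {1..} e" and bounded: "bounded_clinear S"
    and shift: "1 \<le> n \<Longrightarrow> S (e n) = complex_of_real (a n) *\<^sub>C e (n + 1)"
begin

abbreviation adj :: "'h \<Rightarrow> 'h" where "adj \<equiv> adjoint_op S"

text \<open>The conditional realises the convention that the weight before the first is zero; the
  actual value \<open>a 0\<close> is arbitrary.\<close>

definition weight_gap :: "nat \<Rightarrow> real" where
  "weight_gap n = (a n)\<^sup>2 - (if n = 1 then 0 else (a (n - 1))\<^sup>2)"

lemma cinner_basis: "1 \<le> m \<Longrightarrow> 1 \<le> n \<Longrightarrow> cinner (e m) (e n) = (if m = n then 1 else 0)"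
  using basis by (simp add: orthonormal_basis_def)

lemma norm_basis: "1 \<le> n \<Longrightarrow> norm (e n) = 1"
  by (simp add: norm_eq_sqrt_cinner cinner_basis)

lemma adj_first: "adj (e 1) = 0"
  by (rule orthonormal_basis_eqI[OF basis])
    (simp add: shift cinner_scaleC_left cinner_basis flip: cinner_adjoint_right[OF bounded])

lemma adj_Suc: "1 \<le> n \<Longrightarrow> adj (e (n + 1)) = complex_of_real (a n) *\<^sub>C e n"
  by (rule orthonormal_basis_eqI[OF basis])
    (simp add: shift cinner_scaleC_left cinner_scaleC_right cinner_basis
      flip: cinner_adjoint_right[OF bounded])

lemma self_commutator_basis:
  assumes "1 \<le> n"
  shows "self_commutator S (e n) = complex_of_real (weight_gap n) *\<^sub>C e n"
proof -
  note S_scale = clinear_scaleC[OF bounded_clinear_clinear[OF bounded]]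
  note adj_scale = clinear_scaleC[OF bounded_clinear_clinear[OF bounded_clinear_adjoint[OF bounded]]]
  have 1: "adj (S (e n)) = complex_of_real ((a n)\<^sup>2) *\<^sub>C e n"
    using adj_Suc[OF assms]
    by (simp add: shift[OF assms] adj_scale scaleC_scaleC power2_eq_square)
  have 2: "S (adj (e n)) = complex_of_real (if n = 1 then 0 else (a (n - 1))\<^sup>2) *\<^sub>C e n"
  proof (cases "n = 1")
    case True
    then show ?thesis
      using adj_first S_scale[of 0 0] by simp
  next
    case False
    then have "1 \<le> n - 1" "n - 1 + 1 = n" using assms by auto
    then show ?thesis
      using adj_Suc[of "n - 1"] shift[of "n - 1"] False
      by (simp add: S_scale scaleC_scaleC power2_eq_square)
  qed
  show ?thesis
    by (simp only: self_commutator_def 1 2 weight_gap_def of_real_diff cvec.scale_left_diff_distrib)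
qed

lemma adj_self_commutator_shift_basis:
  assumes "1 \<le> n"
  shows "adj (self_commutator S (S (e n))) = complex_of_real ((a n)\<^sup>2 * weight_gap (n + 1)) *\<^sub>C e n"
proof -
  note Q_scale = clinear_scaleC[OF bounded_clinear_clinear[OF bounded_clinear_self_commutator[OF bounded]]]
  note adj_scale = clinear_scaleC[OF bounded_clinear_clinear[OF bounded_clinear_adjoint[OF bounded]]]
  show ?thesis
    using adj_Suc[OF assms] self_commutator_basis[of "n + 1"]
    by (simp add: shift[OF assms] Q_scale adj_scale scaleC_scaleC power2_eq_square mult_ac)
qed

text \<open>Both operators are diagonal in the basis \<open>e\<close>, so the operator inequality
  reduces to one between their entries.\<close>

lemma near_subnormal_if_weight_gap:
  assumes "hyponormal S" and "0 < m"
    and gap: "\<And>n. 1 \<le> n \<Longrightarrow> m * ((a n)\<^sup>2 * weight_gap (n + 1)) \<le> weight_gap n"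
  shows "near_subnormal S"
proof -
  have "positive_op (\<lambda>x. self_commutator S x - m *\<^sub>R adj (self_commutator S (S x)))"
  proof (rule positive_op_diagonal[OF _ basis])
    show "bounded_clinear (\<lambda>x. self_commutator S x - m *\<^sub>R adj (self_commutator S (S x)))"
      by (intro bounded_clinear_diff bounded_clinear_scaleR
          bounded_clinear_compose[OF bounded_clinear_adjoint[OF bounded]
            bounded_clinear_compose[OF bounded_clinear_self_commutator[OF bounded] bounded]]
          bounded_clinear_self_commutator bounded)
    show "self_commutator S (e n) - m *\<^sub>R adj (self_commutator S (S (e n)))
        = complex_of_real (weight_gap n - m * ((a n)\<^sup>2 * weight_gap (n + 1))) *\<^sub>C e n"
      if "n \<in> {1..}" for n
    proof -
      have "1 \<le> n" using that by simp
      then show ?thesis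
        by (simp only: self_commutator_basis adj_self_commutator_shift_basis scaleR_scaleC
            scaleC_scaleC of_real_diff of_real_mult cvec.scale_left_diff_distrib)
    qed
    show "0 \<le> weight_gap n - m * ((a n)\<^sup>2 * weight_gap (n + 1))" if "n \<in> {1..}" for n
      using gap[of n] that by simp
  qed
  then show ?thesis
    using assms(1,2) by (auto simp: near_subnormal_def op_ge_def)
qed

end

section \<open>Normal extensions and equal weights\<close>

text \<open>The vectors \<open>v\<close>, \<open>u\<close>, \<open>x\<close> stand for the images of
  \<open>e i\<close>, \<open>e (i - 1)\<close>, \<open>e (i - 2)\<close> in the larger
  space.\<close>

lemma normal_extension_weight_eq:
  fixes N :: "'k::complex_hilbert \<Rightarrow> 'k" and c :: real
  assumes normal: "normal_op N"
    and v: "norm v = 1" "norm (N v) = c" "norm (N (N v)) = c\<^sup>2"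
    and u: "N u = of_real b *\<^sub>C v" and x: "N x = of_real b' *\<^sub>C u" "b' \<noteq> 0"
  shows "norm (N u) = c * norm u"
proof -
  have N: "bounded_clinear N" and comm: "\<And>z. adjoint_op N (N z) = N (adjoint_op N z)"
    using normal by (auto simp: normal_op_def fun_eq_iff)
  define B where "B = adjoint_op N"
  have BN: "cinner (B y) z = cinner y (N z)" and NB: "cinner (N y) z = cinner y (B z)" for y z
    unfolding B_def using cinner_adjoint_left[OF N] cinner_adjoint_right[OF N] by auto
  have comm': "B (N z) = N (B z)" for z
    using comm by (simp add: B_def)
  have norm_B: "norm (B z) = norm (N z)" for z
    unfolding B_def by (rule normal_op_norm_adjoint[OF normal])
  have N_scale: "N (k *\<^sub>C z) = k *\<^sub>C N z" for k z
    by (rule clinear_scaleC[OF bounded_clinear_clinear[OF N]])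
  have B_scale: "B (k *\<^sub>C z) = k *\<^sub>C B z" for k z
    unfolding B_def
    by (rule clinear_scaleC[OF bounded_clinear_clinear[OF bounded_clinear_adjoint[OF N]]])
  have N_diff: "N (y - z) = N y - N z" for y z
    by (rule linear_diff[OF clinear_imp_linear[OF bounded_clinear_clinear[OF N]]])
  txt \<open>Equality holds in the Cauchy-Schwarz inequality for \<open>cinner (B (N v)) v\<close>.\<close>
  have "(norm (B (N v) - c\<^sup>2 *\<^sub>R v))\<^sup>2 = (c\<^sup>2)\<^sup>2 - 2 * (c\<^sup>2 * c\<^sup>2) + (c\<^sup>2)\<^sup>2"
    unfolding norm_diff_square
    by (simp add: norm_B v cinner_scaleR_right BN cinner_self)
  then have "B (N v) = of_real (c\<^sup>2) *\<^sub>C v"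
    by (simp add: power2_eq_square scaleR_scaleC)
  \<comment> \<open>As \<open>N u\<close> is a multiple of \<open>v\<close>, commutation transfers
    the eigenvector relation from \<open>v\<close> to \<open>N u\<close>.\<close>
  then have BNN: "N (B (N u)) = of_real (c\<^sup>2) *\<^sub>C N u"
    by (simp add: u B_scale N_scale scaleC_scaleC mult.commute flip: comm')
  define w where "w = B (N u) - of_real (c\<^sup>2) *\<^sub>C u"
  have Nw: "N w = 0"
    unfolding w_def N_diff BNN N_scale by simp
  then have Bw: "B w = 0"
    using norm_B[of w] by simp
  \<comment> \<open>Here \<open>x\<close> serves to put \<open>u\<close> into the range of
    \<open>N\<close>, which is orthogonal to the kernel of \<open>B\<close>.\<close>
  have "of_real b' * cinner u w = cinner x (B w)"
    by (simp add: x cinner_scaleC_left flip: NB)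
  then have uw: "cinner u w = 0"
    using Bw x(2) by simp
  \<comment> \<open>The left argument is \<open>w\<close> itself; moving \<open>B\<close> across
    leaves \<open>N w = 0\<close>.\<close>
  have "cinner (B (N u) - of_real (c\<^sup>2) *\<^sub>C u) w = 0"
    by (simp add: BN Nw uw cinner_diff_left cinner_scaleC_left)
  then have "w = 0"
    unfolding w_def[symmetric] by (simp add: cinner_eq_zero_iff)
  then have "B (N u) = of_real (c\<^sup>2) *\<^sub>C u"
    by (simp add: w_def)
  then have "cinner (N u) (N u) = of_real (c\<^sup>2) * cinner u u"
    using BN[of "N u" u] by (simp add: cinner_scaleC_left)
  then have "of_real ((norm (N u))\<^sup>2) = (of_real ((c * norm u)\<^sup>2) :: complex)"
    by (simp add: cinner_self power_mult_distrib)
  then have "(norm (N u))\<^sup>2 = (c * norm u)\<^sup>2"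
    using of_real_eq_iff by blast
  moreover have "0 \<le> c" using v(2) norm_ge_zero by metis
  ultimately show ?thesis
    by (simp add: power2_eq_iff_nonneg)
qed

text \<open>One backward step of Stampfli's propagation of equal weights. The bound on
  \<open>i\<close> makes \<open>i - 2\<close> a genuine basis index.\<close>

lemma (in weighted_shift) subnormal_weights_eq:
  assumes "subnormal_in TYPE('k::complex_hilbert) S"
    and i: "3 \<le> i" and pos: "0 < a (i - 2)" "0 < a (i - 1)" "0 < a i" and eq: "a (i + 1) = a i"
  shows "a (i - 1) = a i"
proof -
  obtain V :: "'h \<Rightarrow> 'k" and N where V: "clinear V" "\<And>x y. cinner (V x) (V y) = cinner x y"
    and N: "normal_op N" and NV: "\<And>x. N (V x) = V (S x)"
    using assms(1) unfolding subnormal_in_def by blast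
  have norm_V: "norm (V x) = norm x" for x
    by (simp add: norm_eq_sqrt_cinner V(2))
  have NVe: "N (V (e n)) = of_real (a n) *\<^sub>C V (e (n + 1))" if "1 \<le> n" for n
    using that by (simp add: NV shift clinear_scaleC[OF V(1)])
  have Suc_simps: "i - 1 + 1 = i" "i - 2 + 1 = i - 1" using i by auto
  have "norm (N (V (e (i - 1)))) = a i * norm (V (e (i - 1)))"
  proof (rule normal_extension_weight_eq[OF N])
    show "norm (V (e i)) = 1"
      using i by (simp add: norm_V norm_basis)
    show "norm (N (V (e i))) = a i"
      using i pos by (simp add: NVe norm_scaleC norm_V norm_basis)
    \<comment> \<open>The norm is \<open>a i * a (i + 1)\<close>; this is where the equality of
      consecutive weights enters.\<close>
    show "norm (N (N (V (e i)))) = (a i)\<^sup>2"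
      using i pos eq
      by (simp add: NV norm_V shift norm_scaleC norm_mult norm_basis power2_eq_square
          clinear_scaleC[OF bounded_clinear_clinear[OF bounded]])
    show "N (V (e (i - 1))) = of_real (a (i - 1)) *\<^sub>C V (e i)"
      using i NVe[of "i - 1"] Suc_simps by simp
    show "N (V (e (i - 2))) = of_real (a (i - 2)) *\<^sub>C V (e (i - 1))"
      using i NVe[of "i - 2"] Suc_simps by simp
    show "a (i - 2) \<noteq> 0" using pos by simp
  qed
  then show ?thesis
    using i pos NVe[of "i - 1"] Suc_simps by (simp add: norm_scaleC norm_V norm_basis)
qed

theorem theorem2:
  fixes e :: "nat \<Rightarrow> 'h::complex_hilbert"
    and S :: "'h \<Rightarrow> 'h"
    and a :: "nat \<Rightarrow> real"
  assumes "\<exists>D :: 'h set. countable D \<and> closure D = UNIV"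
    and "orthonormal_basis {1..} e"
    and "bounded_clinear S"
    and "hyponormal S"
    and "\<forall>n\<ge>1. S (e n) = complex_of_real (a n) *\<^sub>C e (n + 1)"
    and "\<exists>i\<ge>3. 0 < a 1 \<and> (\<forall>n. 1 \<le> n \<and> n < i \<longrightarrow> a n < a (n + 1)) \<and> (\<forall>n\<ge>i + 1. a n = a i)"
  shows "near_subnormal S \<and> \<not> subnormal_in TYPE('k::complex_hilbert) S"
proof -
  interpret weighted_shift e S a
    using assms(2,3,5) by unfold_locales auto
  obtain i where i: "3 \<le> i" and a1: "0 < a 1"
    and incr: "\<And>n. 1 \<le> n \<Longrightarrow> n < i \<Longrightarrow> a n < a (n + 1)" and const: "\<And>n. i + 1 \<le> n \<Longrightarrow> a n = a i"
    using assms(6) by blast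
  have pos: "0 < a n" if "1 \<le> n" "n \<le> i" for n
    using that
  proof (induction n rule: dec_induct)
    case base
    show ?case by (rule a1)
  next
    case (step n)
    then show ?case using incr[of n] by simp
  qed
  have gap_pos: "0 < weight_gap n" if "1 \<le> n" "n \<le> i" for n
  proof (cases "n = 1")
    case True
    then show ?thesis using a1 by (simp add: weight_gap_def)
  next
    case False
    then have "a (n - 1) < a n" "0 < a (n - 1)"
      using that incr[of "n - 1"] pos[of "n - 1"] by auto
    then show ?thesis
      using False by (simp add: weight_gap_def power_strict_mono)
  qed
  \<comment> \<open>At \<open>n = i + 1\<close> the preceding weight is \<open>a i\<close> itself,
    which \<open>const\<close> does not cover.\<close>
  have gap_zero: "weight_gap n = 0" if "i + 1 \<le> n" for n
    using that i const[of n] const[of "n - 1"] by (cases "n = i + 1") (auto simp: weight_gap_def)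
  \<comment> \<open>\<open>q n\<close> is the largest factor allowed at index \<open>n\<close>. Only
    \<open>n < i\<close> gives a constraint, and there the denominator is positive.\<close>
  define q where "q n = weight_gap n / ((a n)\<^sup>2 * weight_gap (n + 1))" for n
  define m where "m = Min (q ` {1..<i})"
  have q_pos: "0 < q n" if "n \<in> {1..<i}" for n
    using that pos[of n] gap_pos[of n] gap_pos[of "n + 1"] by (simp add: q_def)
  have "m \<in> q ` {1..<i}"
    unfolding m_def using i by (intro Min_in) auto
  then have "0 < m" using q_pos by auto
  have "near_subnormal S"
  proof (rule near_subnormal_if_weight_gap[OF assms(4) \<open>0 < m\<close>])
    fix n :: nat assume n: "1 \<le> n"
    show "m * ((a n)\<^sup>2 * weight_gap (n + 1)) \<le> weight_gap n"
    proof (cases "n < i")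
      case True
      then have "m \<le> q n"
        unfolding m_def using n by (intro Min_le) auto
      moreover have "0 < (a n)\<^sup>2 * weight_gap (n + 1)"
        using n True pos[of n] gap_pos[of "n + 1"] by simp
      ultimately show ?thesis
        by (simp add: q_def pos_le_divide_eq)
    next
      case False
      \<comment> \<open>The left side vanishes from \<open>n = i\<close> on, while the right side is
        positive at \<open>i\<close> and zero beyond.\<close>
      then show ?thesis
        using n gap_zero[of "n + 1"] gap_zero[of n] gap_pos[of n] by (cases "n = i") auto
    qed
  qed
  moreover have "\<not> subnormal_in TYPE('k) S"
  proof
    assume "subnormal_in TYPE('k) S"
    then have "a (i - 1) = a i"
      by (rule subnormal_weights_eq) (use i pos const in auto)
    moreover have "1 \<le> i - 1" "i - 1 < i" "i - 1 + 1 = i"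
      using i by auto
    ultimately show False
      using incr[of "i - 1"] by simp
  qed
  ultimately show ?thesis by blast
qed

end
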